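(* Let $Y=G^{(Q)}_{\mu,\nu}(a,b)$ be an Integral Grand Lebesgue Space with $Q>1$. Then for every measurable $g:T\to\mathbb R$, $$\|g\|_{Y^*}\le\|g\|_{Q'},\qquad\text{where}\quad \|g\|_{Q'}=\left[\int_a^b|g|_{p'}^{Q'}\,\nu(dp)\right]^{1/Q'} .$$
   Context: Let $(T,\mathcal A,\mu)$ be a measurable space with a non-trivial sigma-finite measure $\mu$. For measurable $f:T\to\mathbb R$ put $|f|_p=\left(\int_T|f|^p\,d\mu\right)^{1/p}$. Let $1\le a<b\le\infty$ and let $\nu$ be a sigma-finite Borel measure on the interval $(a,b)$. The Integral Grand Lebesgue Space $Y=G^{(Q)}_{\mu,\nu}(a,b)$ is the set of all measurable $f:T\to\mathbb R$ with finite norm $\|f\|_Y=\left[\int_a^b|f|_p^Q\,\nu(dp)\right]^{1/Q}$. For $Q,p>1$ put $Q'=Q/(Q-1)$ and $p'=p/(p-1)$. Every continuous linear functional on $Y$ has the form $l_g(f)=\int_Tf(t)g(t)\,\mu(dt)$ with $g$ measurable, and its norm (the norm in the conjugate space $Y^*$, which coincides with the associate space $Y'$) is $$\|g\|_{Y^*}=\|g\|_{Y'}=\sup_{f:\,\|f\|_Y=1}\left|\int_Tf(t)g(t)\,\mu(dt)\right| .$$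
   Formalization: The measure ν is additionally assumed to have total mass ν((a,b)) ≥ 1; without it the inequality fails, e.g. for μ a unit point mass, ν = (1/4)δ_2 on (1,3), Q = 2, g = 1, where the left side is 2 and the right side 1/2. *)

theory Defs
  imports "HOL-Analysis.Analysis"
begin

text \<open>
  All norms take values in \<open>ennreal\<close>, so that an infinite norm is a value and not an undefined
  term. The library has no real powers on \<open>ennreal\<close>; the definition below is meant for a strictly
  positive exponent, where the power of \<open>\<infinity>\<close> is \<open>\<infinity>\<close>.
\<close>

definition epowr :: "ennreal \<Rightarrow> real \<Rightarrow> ennreal" where
  "epowr x r = (if x = \<infinity> then \<infinity> else ennreal (enn2real x powr r))"

definition Lp_enorm :: "'a measure \<Rightarrow> real \<Rightarrow> ('a \<Rightarrow> real) \<Rightarrow> ennreal" where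
  "Lp_enorm M p f = epowr (\<integral>\<^sup>+ t. ennreal (\<bar>f t\<bar> powr p) \<partial>M) (1 / p)"

definition conj_exp :: "real \<Rightarrow> real" where
  "conj_exp p = p / (p - 1)"

text \<open>The right endpoint may be infinite; the exponents in the interval are always finite.\<close>

definition exponent_interval :: "real \<Rightarrow> ereal \<Rightarrow> real set" where
  "exponent_interval a b = {p. a < p \<and> ereal p < b}"

text \<open>
  The interval of integration is not a parameter of the norms: \<open>\<nu>\<close> is a measure whose space is
  the interval. The inequality between the dual norm and the conjugate norm below is sensitive to
  the total mass of \<open>\<nu>\<close>: for \<open>\<nu>\<close> of mass \<open>c\<close> concentrated in one exponent \<open>p\<close>, the two sides are
  \<open>c\<^sup>-\<^sup>1\<^sup>/\<^sup>Q |g|\<^sub>p\<^sub>'\<close> and \<open>c\<^sup>1\<^sup>-\<^sup>1\<^sup>/\<^sup>Q |g|\<^sub>p\<^sub>'\<close>. Hence it is stated for \<open>\<nu>\<close> of total mass at least \<open>1\<close>.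
\<close>

definition IGLS_norm :: "'a measure \<Rightarrow> real measure \<Rightarrow> real \<Rightarrow> ('a \<Rightarrow> real) \<Rightarrow> ennreal" where
  "IGLS_norm M \<nu> Q f = epowr (\<integral>\<^sup>+ p. epowr (Lp_enorm M p f) Q \<partial>\<nu>) (1 / Q)"

definition IGLS :: "'a measure \<Rightarrow> real measure \<Rightarrow> real \<Rightarrow> ('a \<Rightarrow> real) set" where
  "IGLS M \<nu> Q = {f \<in> borel_measurable M. IGLS_norm M \<nu> Q f < \<infinity>}"

text \<open>
  The value \<open>|l\<^sub>g(f)|\<close>. The Bochner integral of a non-integrable function is \<open>0\<close> by convention, which
  would let a \<open>g\<close> that defines no functional on the space have a small dual norm; the value is
  therefore \<open>\<infinity>\<close> if \<open>f g\<close> is not integrable.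
\<close>

definition abs_pairing :: "'a measure \<Rightarrow> ('a \<Rightarrow> real) \<Rightarrow> ('a \<Rightarrow> real) \<Rightarrow> ennreal" where
  "abs_pairing M g f =
    (if integrable M (\<lambda>t. f t * g t) then ennreal \<bar>LINT t|M. f t * g t\<bar> else \<infinity>)"

definition IGLS_dual_norm :: "'a measure \<Rightarrow> real measure \<Rightarrow> real \<Rightarrow> ('a \<Rightarrow> real) \<Rightarrow> ennreal" where
  "IGLS_dual_norm M \<nu> Q g = (SUP f \<in> {f \<in> IGLS M \<nu> Q. IGLS_norm M \<nu> Q f = 1}. abs_pairing M g f)"

definition IGLS_conj_norm :: "'a measure \<Rightarrow> real measure \<Rightarrow> real \<Rightarrow> ('a \<Rightarrow> real) \<Rightarrow> ennreal" where
  "IGLS_conj_norm M \<nu> Q g =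
    epowr (\<integral>\<^sup>+ p. epowr (Lp_enorm M (conj_exp p) g) (conj_exp Q) \<partial>\<nu>) (1 / conj_exp Q)"

end

theory Submission
  imports Defs
begin

text \<open>
  Let \<open>f\<close> have norm \<open>1\<close> and put \<open>I = \<integral>\<^sup>+ |f g| d\<mu>\<close>. The Hoelder inequality on the base space
  gives \<open>I \<le> |f|\<^sub>p |g|\<^sub>p\<^sub>'\<close> for every exponent \<open>p\<close> of the interval, and \<open>I\<close> does not depend on \<open>p\<close>.
  Integrate over \<open>p\<close>: the left side becomes \<open>I\<close> times the total mass of \<open>\<nu>\<close>, which is at least \<open>I\<close>,
  and a second Hoelder inequality, now on the interval with the exponents \<open>Q\<close> and \<open>Q'\<close>, bounds
  the right side by the product of the norm of \<open>f\<close> and the conjugate norm of \<open>g\<close>.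

  Both steps are instances of one inequality for functions with values in \<open>[0, \<infinity>]\<close>
  (\<open>nn_integral_Holder\<close>); the second one needs infinite values, because \<open>|f|\<^sub>p\<close> and \<open>|g|\<^sub>p\<^sub>'\<close> may be
  infinite for some \<open>p\<close>. It also needs \<open>|f|\<^sub>p\<close> to be measurable in \<open>p\<close>; this is Tonelli's theorem and
  the place where \<open>\<mu>\<close> has to be sigma-finite (\<open>measurable_Lp_enorm\<close>). Working with \<open>I\<close> in place
  of the integral of \<open>f g\<close> also settles integrability: if \<open>f g\<close> is not integrable, \<open>I\<close> is infinite.
\<close>

lemma epowr_0 [simp]: "epowr 0 r = 0"
  by (simp add: epowr_def)

lemma epowr_top [simp]: "epowr top r = top"
  by (simp add: epowr_def)

lemma epowr_ennreal: "0 \<le> x \<Longrightarrow> epowr (ennreal x) r = ennreal (x powr r)"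
  by (simp add: epowr_def)

lemma epowr_eq_0_iff: "epowr x r = 0 \<longleftrightarrow> x = 0"
  by (cases x) (auto simp: epowr_def)

lemma measurable_epowr [measurable (raw)]:
  assumes [measurable]: "f \<in> borel_measurable M" "r \<in> borel_measurable M"
  shows "(\<lambda>x. epowr (f x) (r x)) \<in> borel_measurable M"
  unfolding epowr_def by measurable

lemma conj_exp_gt_1: "1 < p \<Longrightarrow> 1 < conj_exp p"
  by (simp add: conj_exp_def field_simps)

lemma inverse_conj_exp: "1 < p \<Longrightarrow> 1 / p + 1 / conj_exp p = 1"
  by (simp add: conj_exp_def field_simps)

text \<open>
  The inequality \<open>x y \<le> x\<^sup>p/p + y\<^sup>q/q\<close>, applied after dividing \<open>x\<close> by \<open>A\<^sup>1\<^sup>/\<^sup>p\<close> and \<open>y\<close> by \<open>B\<^sup>1\<^sup>/\<^sup>q\<close>.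
  In this form it can be integrated directly, with \<open>A\<close> and \<open>B\<close> the integrals of the two powers: the
  bracket then integrates to \<open>1/p + 1/q = 1\<close>.
\<close>

lemma Young_epowr:
  fixes x y :: ennreal and p :: real
  assumes p: "1 < p" and A: "0 < A" and B: "0 < B"
  defines "q \<equiv> conj_exp p"
  shows "x * y \<le> ennreal (A powr (1 / p) * B powr (1 / q)) *
    (ennreal (1 / (p * A)) * epowr x p + ennreal (1 / (q * B)) * epowr y q)"
proof -
  define C where "C = A powr (1 / p) * B powr (1 / q)"
  have q: "1 < q" "1 / p + 1 / q = 1"
    using conj_exp_gt_1[OF p] inverse_conj_exp[OF p] by (simp_all add: q_def)
  have C: "0 < C" using A B by (simp add: C_def)
  show ?thesis unfolding C_def[symmetric]
  proof (cases "x = \<infinity> \<or> y = \<infinity>")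
    case True
    then have "ennreal C * (ennreal (1 / (p * A)) * epowr x p + ennreal (1 / (q * B)) * epowr y q) = \<infinity>"
      using C A B p q by (auto simp: ennreal_mult_eq_top_iff)
    then show "x * y \<le> ennreal C * (ennreal (1 / (p * A)) * epowr x p + ennreal (1 / (q * B)) * epowr y q)" by simp
  next
    case False
    then obtain u v where uv: "x = ennreal u" "0 \<le> u" "y = ennreal v" "0 \<le> v"
      by (cases x; cases y) auto
    have "(u / A powr (1 / p)) * (v / B powr (1 / q))
        \<le> (u / A powr (1 / p)) powr p / p + (v / B powr (1 / q)) powr q / q"
      using p q uv by (intro Youngs_inequality) auto
    also have "\<dots> = 1 / (p * A) * u powr p + 1 / (q * B) * v powr q"
      using A B p q uv by (simp add: powr_divide powr_powr mult.commute)
    finally have "u * v \<le> C * (1 / (p * A) * u powr p + 1 / (q * B) * v powr q)"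
      using A B by (simp add: C_def field_simps)
    then have "ennreal (u * v) \<le> ennreal (C * (1 / (p * A) * u powr p + 1 / (q * B) * v powr q))"
      by (rule ennreal_leI)
    also have "\<dots> = ennreal C * (ennreal (1 / (p * A)) * epowr x p + ennreal (1 / (q * B)) * epowr y q)"
      using A B p q C uv by (simp add: epowr_ennreal ennreal_mult[symmetric] ennreal_plus[symmetric] del: ennreal_plus)
    finally show "x * y \<le> ennreal C * (ennreal (1 / (p * A)) * epowr x p + ennreal (1 / (q * B)) * epowr y q)"
      using uv by (simp add: ennreal_mult)
  qed
qed

text \<open>
  The inequality also holds when one factor on the right is \<open>0\<close> and the other \<open>\<infinity>\<close>, where the product
  is \<open>0\<close>: a vanishing factor forces \<open>F\<close> or \<open>G\<close> to be zero almost everywhere.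
\<close>

lemma nn_integral_Holder:
  fixes F G :: "'a \<Rightarrow> ennreal"
  assumes [measurable]: "F \<in> borel_measurable M" "G \<in> borel_measurable M" and p: "1 < p"
  defines "q \<equiv> conj_exp p"
  shows "(\<integral>\<^sup>+ x. F x * G x \<partial>M) \<le>
    epowr (\<integral>\<^sup>+ x. epowr (F x) p \<partial>M) (1 / p) * epowr (\<integral>\<^sup>+ x. epowr (G x) q \<partial>M) (1 / q)"
proof -
  define S T where "S = (\<integral>\<^sup>+ x. epowr (F x) p \<partial>M)" and "T = (\<integral>\<^sup>+ x. epowr (G x) q \<partial>M)"
  have q: "1 < q" "1 / p + 1 / q = 1"
    using conj_exp_gt_1[OF p] inverse_conj_exp[OF p] by (simp_all add: q_def)
  consider "S = 0 \<or> T = 0" | "S \<noteq> 0" "T \<noteq> 0" "S = \<infinity> \<or> T = \<infinity>"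
    | "S \<noteq> 0" "T \<noteq> 0" "S \<noteq> \<infinity>" "T \<noteq> \<infinity>" by blast
  then show ?thesis unfolding S_def[symmetric] T_def[symmetric]
  proof cases
    case 1
    then have "(AE x in M. F x = 0) \<or> (AE x in M. G x = 0)"
      by (simp add: S_def T_def nn_integral_0_iff_AE epowr_eq_0_iff)
    then have "AE x in M. F x * G x = 0" by auto
    then have "(\<integral>\<^sup>+ x. F x * G x \<partial>M) = 0" by (subst nn_integral_0_iff_AE) auto
    then show "(\<integral>\<^sup>+ x. F x * G x \<partial>M) \<le> epowr S (1 / p) * epowr T (1 / q)" by simp
  next
    case 2
    then have "epowr S (1 / p) * epowr T (1 / q) = \<infinity>"
      by (auto simp: ennreal_mult_eq_top_iff epowr_eq_0_iff)
    then show "(\<integral>\<^sup>+ x. F x * G x \<partial>M) \<le> epowr S (1 / p) * epowr T (1 / q)" by simp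
  next
    case 3
    then obtain A B where AB: "S = ennreal A" "0 < A" "T = ennreal B" "0 < B"
      by (cases S; cases T) (auto simp: less_le)
    define C where "C = A powr (1 / p) * B powr (1 / q)"
    have C: "0 < C" using AB by (simp add: C_def)
    have "(\<integral>\<^sup>+ x. F x * G x \<partial>M) \<le> (\<integral>\<^sup>+ x. ennreal C *
        (ennreal (1 / (p * A)) * epowr (F x) p + ennreal (1 / (q * B)) * epowr (G x) q) \<partial>M)"
      unfolding C_def q_def using p AB by (intro nn_integral_mono Young_epowr) auto
    also have "\<dots> = ennreal C * (ennreal (1 / (p * A)) * S + ennreal (1 / (q * B)) * T)"
      by (simp add: nn_integral_cmult nn_integral_add S_def T_def)
    also have "\<dots> = ennreal (C * (1 / p + 1 / q))"
      using AB C p q(1)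
      by (simp add: ennreal_mult[symmetric] ennreal_plus[symmetric] field_simps del: ennreal_plus)
    also have "\<dots> = epowr S (1 / p) * epowr T (1 / q)"
      unfolding q(2) using AB by (simp add: C_def epowr_ennreal ennreal_mult)
    finally show "(\<integral>\<^sup>+ x. F x * G x \<partial>M) \<le> epowr S (1 / p) * epowr T (1 / q)" .
  qed
qed

lemma abs_pairing_le_nn_integral:
  assumes [measurable]: "f \<in> borel_measurable M" "g \<in> borel_measurable M"
  shows "abs_pairing M g f \<le> (\<integral>\<^sup>+ t. ennreal \<bar>f t\<bar> * ennreal \<bar>g t\<bar> \<partial>M)"
proof (cases "integrable M (\<lambda>t. f t * g t)")
  case True
  then show ?thesis
    using integral_norm_bound_ennreal[OF True]
    by (simp add: abs_pairing_def abs_mult ennreal_mult)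
next
  case False
  then have "(\<integral>\<^sup>+ t. ennreal \<bar>f t\<bar> * ennreal \<bar>g t\<bar> \<partial>M) = \<infinity>"
    by (simp add: integrable_iff_bounded abs_mult ennreal_mult top.not_eq_extremum[symmetric])
  then show ?thesis by simp
qed

lemma nn_integral_le_Lp_enorm_mult:
  assumes [measurable]: "f \<in> borel_measurable M" "g \<in> borel_measurable M" and p: "1 < p"
  shows "(\<integral>\<^sup>+ t. ennreal \<bar>f t\<bar> * ennreal \<bar>g t\<bar> \<partial>M) \<le> Lp_enorm M p f * Lp_enorm M (conj_exp p) g"
  using nn_integral_Holder[of "\<lambda>t. ennreal \<bar>f t\<bar>" M "\<lambda>t. ennreal \<bar>g t\<bar>" p] p
  by (simp add: Lp_enorm_def epowr_ennreal)

lemma measurable_Lp_enorm [measurable (raw)]: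
  assumes "sigma_finite_measure M"
    and [measurable]: "f \<in> borel_measurable M" "h \<in> borel_measurable N"
  shows "(\<lambda>p. Lp_enorm M (h p) f) \<in> borel_measurable N"
proof -
  interpret sigma_finite_measure M by fact
  show ?thesis unfolding Lp_enorm_def by measurable
qed

theorem theorem6p1:
  fixes M :: "'a measure" and \<nu> :: "real measure"
    and a :: real and b :: ereal and Q :: real and g :: "'a \<Rightarrow> real"
  assumes "sigma_finite_measure M" and "emeasure M (space M) \<noteq> 0"
    and "1 \<le> a" and "ereal a < b"
    and "sigma_finite_measure \<nu>"
    and "space \<nu> = exponent_interval a b"
    and "sets \<nu> = sets (restrict_space borel (exponent_interval a b))"
    and "1 \<le> emeasure \<nu> (exponent_interval a b)"
    and "Q > 1"
    and "g \<in> borel_measurable M"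
  shows "IGLS_dual_norm M \<nu> Q g \<le> IGLS_conj_norm M \<nu> Q g"
  unfolding IGLS_dual_norm_def
proof (rule SUP_least)
  fix f assume "f \<in> {f \<in> IGLS M \<nu> Q. IGLS_norm M \<nu> Q f = 1}"
  then have f [measurable]: "f \<in> borel_measurable M" and norm_f: "IGLS_norm M \<nu> Q f = 1"
    by (auto simp: IGLS_def)
  note [measurable] = \<open>g \<in> borel_measurable M\<close>
  define I where "I = (\<integral>\<^sup>+ t. ennreal \<bar>f t\<bar> * ennreal \<bar>g t\<bar> \<partial>M)"
  have [measurable]: "(\<lambda>p. p) \<in> borel_measurable \<nu>"
    using assms(7) by (simp add: measurable_cong_sets[OF assms(7) refl] measurable_restrict_space1)
  have [measurable]: "conj_exp \<in> borel_measurable \<nu>"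
    unfolding conj_exp_def[abs_def] by measurable
  have "abs_pairing M g f \<le> I"
    unfolding I_def by (rule abs_pairing_le_nn_integral) measurable
  also have "\<dots> \<le> I * emeasure \<nu> (space \<nu>)"
    using mult_left_mono[of 1 "emeasure \<nu> (space \<nu>)" I] assms(6,8) by simp
  also have "\<dots> = (\<integral>\<^sup>+ p. I \<partial>\<nu>)"
    by simp
  also have "\<dots> \<le> (\<integral>\<^sup>+ p. Lp_enorm M p f * Lp_enorm M (conj_exp p) g \<partial>\<nu>)"
    unfolding I_def using assms(3,6)
    by (intro nn_integral_mono nn_integral_le_Lp_enorm_mult) (auto simp: exponent_interval_def)
  also have "\<dots> \<le> IGLS_norm M \<nu> Q f * IGLS_conj_norm M \<nu> Q g"
    unfolding IGLS_norm_def IGLS_conj_norm_def using assms(1,9)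
    by (intro nn_integral_Holder measurable_Lp_enorm) measurable
  also have "\<dots> = IGLS_conj_norm M \<nu> Q g"
    by (simp add: norm_f)
  finally show "abs_pairing M g f \<le> IGLS_conj_norm M \<nu> Q g" .
qed

end
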